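(* Let $X$ be a locally compact Hausdorff space. The following are equivalent: (1) $\mathbf{TM}(X)$ is nowhere dense in $\mathbf{DTM}(X)$. (2) There exists a finite deficient topological measure on $X$ that is not a topological measure. (3) There exists a nonzero finite proper deficient topological measure on $X$ that is not a topological measure.
   Context: $\mathcal{O}(X)$, $\mathcal{C}(X)$, $\mathcal{K}(X)$ are the collections of open, closed, compact subsets of $X$. A deficient topological measure on $X$ is a set function $\nu:\mathcal{C}(X)\cup\mathcal{O}(X)\to[0,\infty]$, not identically $\infty$, such that: (DTM1) $\nu(C\sqcup K)=\nu(C)+\nu(K)$ for disjoint $C,K\in\mathcal{K}(X)$; (DTM2) $\nu(U)=\sup\{\nu(C): C\subseteq U,\ C\in\mathcal{K}(X)\}$ for $U\in\mathcal{O}(X)$; (DTM3) $\nu(F)=\inf\{\nu(U): F\subseteq U,\ U\in\mathcal{O}(X)\}$ for $F\in\mathcal{C}(X)$. A topological measure is a set function $\mu:\mathcal{C}(X)\cup\mathcal{O}(X)\to[0,\infty]$, not identically $\infty$, satisfying (DTM2), (DTM3) and: if $A,B,A\sqcup B\in\mathcal{K}(X)\cup\mathcal{O}(X)$ (disjoint union) then $\mu(A\sqcup B)=\mu(A)+\mu(B)$. $\mathbf{DTM}(X)$, $\mathbf{TM}(X)$ are the sets of finite ($\mu(X)<\infty$) deficient topological measures and finite topological measures. A deficient topological measure $\nu$ is proper if $m\le\nu$ (on $\mathcal{O}(X)\cup\mathcal{C}(X)$) with $m$ a Radon measure implies $m=0$; here a Radon measure is a Borel measure finite on compact sets, outer regular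 on all Borel sets and inner regular (by compact sets) on open sets. $\mathbf{DTM}(X)$ carries the weak topology: the coarsest topology making $\mu\mapsto\int_X f\,d\mu$ continuous for every $f\in C_0^+(X)$ (nonnegative continuous functions vanishing at infinity), where $\int_X f\,d\mu=\int_0^b\mu(f^{-1}((t,\infty)))\,dt$ if $f(X)\subseteq[0,b]$. *)

theory Defs
  imports "HOL-Analysis.Analysis"
begin

section \<open>Deficient topological measures and topological measures\<close>

text \<open>
  The space \<open>X\<close> is the universe of a type of class \<^class>\<open>t2_space\<close>; local compactness is a hypothesis
  of the theorem. A set function on \<open>\<O>(X) \<union> \<C>(X)\<close> is a function on all sets which is
  \<^const>\<open>extensional\<close>, i.e. has a fixed dummy value outside its domain, so that two set functions are
  equal iff they agree on \<open>\<O>(X) \<union> \<C>(X)\<close>.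
\<close>

definition open_or_closed :: "'a::topological_space set set" where
  "open_or_closed = {A. open A \<or> closed A}"

definition inner_compact_regular :: "('a::t2_space set \<Rightarrow> ennreal) \<Rightarrow> bool" where
  "inner_compact_regular \<nu> \<longleftrightarrow> (\<forall>U. open U \<longrightarrow> \<nu> U = (SUP C\<in>{C. compact C \<and> C \<subseteq> U}. \<nu> C))"

definition outer_open_regular :: "('a::t2_space set \<Rightarrow> ennreal) \<Rightarrow> bool" where
  "outer_open_regular \<nu> \<longleftrightarrow> (\<forall>F. closed F \<longrightarrow> \<nu> F = (INF U\<in>{U. open U \<and> F \<subseteq> U}. \<nu> U))"

definition deficient_topological_measure :: "('a::t2_space set \<Rightarrow> ennreal) \<Rightarrow> bool" where
  "deficient_topological_measure \<nu> \<longleftrightarrow>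
     \<nu> \<in> extensional open_or_closed \<and>
     (\<exists>A\<in>open_or_closed. \<nu> A \<noteq> \<infinity>) \<and>
     (\<forall>C K. compact C \<longrightarrow> compact K \<longrightarrow> C \<inter> K = {} \<longrightarrow> \<nu> (C \<union> K) = \<nu> C + \<nu> K) \<and>
     inner_compact_regular \<nu> \<and>
     outer_open_regular \<nu>"

definition topological_measure :: "('a::t2_space set \<Rightarrow> ennreal) \<Rightarrow> bool" where
  "topological_measure \<mu> \<longleftrightarrow>
     \<mu> \<in> extensional open_or_closed \<and>
     (\<exists>A\<in>open_or_closed. \<mu> A \<noteq> \<infinity>) \<and>
     (\<forall>A B. (compact A \<or> open A) \<longrightarrow> (compact B \<or> open B) \<longrightarrow>
        (compact (A \<union> B) \<or> open (A \<union> B)) \<longrightarrow> A \<inter> B = {} \<longrightarrow> \<mu> (A \<union> B) = \<mu> A + \<mu> B) \<and>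
     inner_compact_regular \<mu> \<and>
     outer_open_regular \<mu>"

definition DTM :: "('a::t2_space set \<Rightarrow> ennreal) set" where
  "DTM = {\<nu>. deficient_topological_measure \<nu> \<and> \<nu> UNIV < \<infinity>}"

definition TM :: "('a::t2_space set \<Rightarrow> ennreal) set" where
  "TM = {\<mu>. topological_measure \<mu> \<and> \<mu> UNIV < \<infinity>}"

lemma TM_subset_DTM: "TM \<subseteq> DTM"
  unfolding TM_def DTM_def topological_measure_def deficient_topological_measure_def
  using compact_Un by blast


section \<open>Proper deficient topological measures\<close>

definition radon_measure :: "'a::t2_space measure \<Rightarrow> bool" where
  "radon_measure m \<longleftrightarrow>
     sets m = sets borel \<and>
     (\<forall>K. compact K \<longrightarrow> emeasure m K < \<infinity>) \<and>
     (\<forall>A\<in>sets borel. emeasure m A = (INF U\<in>{U. open U \<and> A \<subseteq> U}. emeasure m U)) \<and>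
     (\<forall>U. open U \<longrightarrow> emeasure m U = (SUP K\<in>{K. compact K \<and> K \<subseteq> U}. emeasure m K))"

definition proper_dtm :: "('a::t2_space set \<Rightarrow> ennreal) \<Rightarrow> bool" where
  "proper_dtm \<nu> \<longleftrightarrow>
     (\<forall>m. radon_measure m \<longrightarrow> (\<forall>A\<in>open_or_closed. emeasure m A \<le> \<nu> A) \<longrightarrow> m = null_measure borel)"


section \<open>The weak topology\<close>

definition C0_plus :: "('a::t2_space \<Rightarrow> real) set" where
  "C0_plus = {f. continuous_on UNIV f \<and> (\<forall>x. 0 \<le> f x) \<and>
                 (\<forall>\<epsilon>>0. \<exists>K. compact K \<and> (\<forall>x. x \<notin> K \<longrightarrow> f x < \<epsilon>))}"

text \<open>
  The integral of \<open>f\<close> is \<open>\<integral>\<^sub>0\<^sup>b \<nu>(f\<^sup>-\<^sup>1((t, \<infinity>))) dt\<close> for any \<open>b\<close> with \<open>f(X) \<subseteq> [0, b]\<close>. The definition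
  takes \<open>b = sup f\<close>; lemma \<open>dtm_integral_eq\<close> below shows that every admissible \<open>b\<close> gives the same value.
\<close>

definition dtm_integral :: "('a::t2_space set \<Rightarrow> ennreal) \<Rightarrow> ('a \<Rightarrow> real) \<Rightarrow> real" where
  "dtm_integral \<nu> f = (LBINT t:{0..(SUP x. f x)}. enn2real (\<nu> (f -` {t<..})))"

definition weak_topology :: "('a::t2_space set \<Rightarrow> ennreal) topology" where
  "weak_topology = topology_generated_by
     {{\<nu> \<in> DTM. dtm_integral \<nu> f \<in> V} | f V. f \<in> C0_plus \<and> open V}"

definition nowhere_dense_in :: "'b topology \<Rightarrow> 'b set \<Rightarrow> bool" where
  "nowhere_dense_in T S \<longleftrightarrow> T interior_of (T closure_of S) = {}"

lemma DTM_empty: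
  assumes "\<nu> \<in> DTM"
  shows "\<nu> {} = 0"
proof -
  have dtm: "deficient_topological_measure \<nu>" and fin: "\<nu> UNIV < \<infinity>"
    using assms by (auto simp: DTM_def)
  have inner: "inner_compact_regular \<nu>"
    using dtm by (simp add: deficient_topological_measure_def)
  have "\<forall>C K. compact C \<longrightarrow> compact K \<longrightarrow> C \<inter> K = {} \<longrightarrow> \<nu> (C \<union> K) = \<nu> C + \<nu> K"
    using dtm by (simp add: deficient_topological_measure_def)
  from this[rule_format, of "{}" "{}"] have add: "\<nu> {} = \<nu> {} + \<nu> {}"
    by simp
  have "\<nu> {} \<le> \<nu> UNIV"
  proof -
    have "\<nu> UNIV = (SUP C\<in>{C. compact C \<and> C \<subseteq> UNIV}. \<nu> C)"
      using inner unfolding inner_compact_regular_def using open_UNIV by blast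
    also have "\<nu> {} \<le> \<dots>"
      by (rule SUP_upper) simp
    finally show ?thesis .
  qed
  with fin have "\<nu> {} \<noteq> \<infinity>" by auto
  with add show ?thesis
    by (metis add.right_neutral ennreal_add_left_cancel infinity_ennreal_def)
qed

lemma dtm_integral_eq:
  assumes "\<nu> \<in> DTM" and "range f \<subseteq> {0..b}"
  shows "dtm_integral \<nu> f = (LBINT t:{0..b}. enn2real (\<nu> (f -` {t<..})))"
proof -
  have bdd: "bdd_above (range f)"
    using assms(2) by (meson bdd_above_Icc bdd_above_mono)
  have le: "f x \<le> (SUP x. f x)" for x
    by (rule cSUP_upper[OF _ bdd]) simp
  have sup: "(SUP x. f x) \<le> b"
    using assms(2) by (intro cSUP_least) (auto simp: image_subset_iff)
  have "\<nu> (f -` {t<..}) = 0" if "t \<ge> (SUP x. f x)" for t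
  proof -
    have "f -` {t<..} = {}"
    proof (rule equals0I)
      fix x assume "x \<in> f -` {t<..}"
      then have "t < f x" by simp
      with le[of x] that show False by linarith
    qed
    then show ?thesis using DTM_empty[OF assms(1)] by simp
  qed
  then show ?thesis
    unfolding dtm_integral_def set_lebesgue_integral_def using sup
    by (intro Bochner_Integration.integral_cong) (auto simp: indicator_def)
qed

lemma topspace_weak_topology [simp]: "topspace weak_topology = DTM"
proof -
  have "(\<lambda>x. 0) \<in> C0_plus"
    by (auto simp: C0_plus_def)
  then have "DTM \<in> {{\<nu> \<in> DTM. dtm_integral \<nu> f \<in> V} | f V. f \<in> C0_plus \<and> open V}"
    by (intro CollectI exI[of _ "\<lambda>x. 0"] exI[of _ UNIV]) simp
  then show ?thesis
    unfolding weak_topology_def topology_generated_by_topspace by (intro equalityI) auto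
qed

lemma continuous_map_dtm_integral:
  assumes "f \<in> C0_plus"
  shows "continuous_map weak_topology euclideanreal (\<lambda>\<nu>. dtm_integral \<nu> f)"
proof -
  have "openin weak_topology {\<nu> \<in> DTM. dtm_integral \<nu> f \<in> V}" if "open V" for V
    unfolding weak_topology_def by (rule topology_generated_by_Basis) (use assms that in blast)
  then show ?thesis
    by (simp add: continuous_map_def)
qed

lemma weak_topology_coarsest:
  assumes "topspace T = DTM"
    and "\<And>f. f \<in> C0_plus \<Longrightarrow> continuous_map T euclideanreal (\<lambda>\<nu>. dtm_integral \<nu> f)"
    and "openin weak_topology W"
  shows "openin T W"
proof -
  have "continuous_map T weak_topology id"
    unfolding weak_topology_def
  proof (rule continuous_on_generated_topo)
    fix S :: "('a set \<Rightarrow> ennreal) set"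
    assume "S \<in> {{\<nu> \<in> DTM. dtm_integral \<nu> f \<in> V} | f V. f \<in> C0_plus \<and> open V}"
    then show "openin T (id -` S \<inter> topspace T)"
      using assms(1,2) by (auto simp: continuous_map_def vimage_def Int_def conj_commute)
  next
    show "id ` topspace T \<subseteq> \<Union> {{\<nu> \<in> DTM. dtm_integral \<nu> f \<in> V} | f V. f \<in> C0_plus \<and> open V}"
      unfolding topology_generated_by_topspace[symmetric] weak_topology_def[symmetric]
      using assms(1) by simp
  qed
  then have "openin T {x \<in> topspace T. id x \<in> W}"
    using assms(3) unfolding continuous_map_def by blast
  moreover have "{x \<in> topspace T. id x \<in> W} = W"
    using openin_subset[OF assms(3)] assms(1) by auto
  ultimately show ?thesis by simp
qed

end

theory Submission
  imports Defs
begin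

text \<open>
  A finite deficient topological measure \<open>\<nu>\<close> is always superadditive, so it can only fail to be a
  topological measure by leaving a gap \<open>\<nu>(C) + \<nu>(U - C) < \<nu>(U)\<close> for some compact \<open>C\<close> inside an open
  \<open>U\<close> (lemma \<open>DTM_topological_measure_iff\<close>). All three statements are traced back to such gaps.

  \<^item> Gaps are stable under small weak perturbations. Urysohn functions turn a gap of \<open>\<nu>\<close> into two
    functions \<open>g \<le> h\<close> for which the integral of \<open>h\<close> against \<open>\<nu>\<close> is larger than the integrals of \<open>g\<close>
    and \<open>h - g\<close> together (lemma \<open>non_TM_integral_gap\<close>). Here \<open>h = 1\<close> wherever \<open>g > 0\<close>, so
    that \<open>g\<close> and \<open>h\<close> are both functions of \<open>g + h\<close>, and the level sets of \<open>h\<close> split into those of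
    \<open>g\<close> and \<open>h - g\<close>; hence no topological measure satisfies that strict inequality (lemma
    \<open>TM_integral_subadditive\<close>). So the topological measures form a weakly closed set.
  \<^item> Gaps survive the addition of any topological measure \<open>\<mu>\<close>: the measure \<open>\<mu>\<close> has none, so
    \<open>\<mu> + c \<nu>\<close> has the gap of \<open>\<nu>\<close> scaled by \<open>c > 0\<close>. As \<open>\<mu> + c \<nu>\<close> tends to \<open>\<mu>\<close>
    for \<open>c\<close> tending to \<open>0\<close>, no topological measure is a weakly interior point of the closed set
    of topological measures, which is therefore nowhere dense as soon as one gap exists.
  \<^item> Gaps survive the removal of a measure, for the same reason. By Zorn's lemma there is a maximal
    Borel measure \<open>m\<close> below \<open>\<nu>\<close>. The difference \<open>\<nu> - m\<close> is again a deficient topological measure,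
    because superadditivity of \<open>\<nu>\<close> dominates additivity of \<open>m\<close>; it is proper because a measure
    below it could be added to \<open>m\<close>; and it keeps the gap of \<open>\<nu>\<close>, hence is not zero.

  If, on the other hand, every finite deficient topological measure is a topological measure, then
  the latter make up the whole nonempty weak space, and are not nowhere dense.
\<close>

section \<open>Finite deficient topological measures\<close>

lemma open_or_closed_openI: "open A \<Longrightarrow> A \<in> open_or_closed"
  and open_or_closed_closedI: "closed A \<Longrightarrow> A \<in> open_or_closed"
  and open_or_closed_compactI: "compact (A::'a::t2_space set) \<Longrightarrow> A \<in> open_or_closed"
  by (auto simp: open_or_closed_def compact_imp_closed)

lemmas open_or_closedI = open_or_closed_openI open_or_closed_closedI open_or_closed_compactI

lemma DTM_additive_compact:
  assumes "\<nu> \<in> DTM" "compact C" "compact K" "C \<inter> K = {}"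
  shows "\<nu> (C \<union> K) = \<nu> C + \<nu> K"
  using assms by (auto simp: DTM_def deficient_topological_measure_def)

lemma DTM_open_eq_SUP:
  assumes "\<nu> \<in> DTM" "open U"
  shows "\<nu> U = (SUP C\<in>{C. compact C \<and> C \<subseteq> U}. \<nu> C)"
  using assms by (auto simp: DTM_def deficient_topological_measure_def inner_compact_regular_def)

lemma DTM_closed_eq_INF:
  assumes "\<nu> \<in> DTM" "closed F"
  shows "\<nu> F = (INF U\<in>{U. open U \<and> F \<subseteq> U}. \<nu> U)"
  using assms by (auto simp: DTM_def deficient_topological_measure_def outer_open_regular_def)

lemma DTM_mono:
  assumes \<nu>: "\<nu> \<in> DTM" and A: "A \<in> open_or_closed" and B: "B \<in> open_or_closed" and sub: "A \<subseteq> B"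
  shows "\<nu> A \<le> \<nu> B"
proof -
  have open_le: "\<nu> A \<le> \<nu> W" if "open W" "A \<subseteq> W" for W
  proof (cases "open A")
    case True
    show ?thesis
      unfolding DTM_open_eq_SUP[OF \<nu> True] DTM_open_eq_SUP[OF \<nu> \<open>open W\<close>]
      using that by (intro SUP_subset_mono) auto
  next
    case False
    then have "closed A" using A by (simp add: open_or_closed_def)
    show ?thesis
      unfolding DTM_closed_eq_INF[OF \<nu> \<open>closed A\<close>] using that by (intro INF_lower) auto
  qed
  show ?thesis
  proof (cases "open B")
    case True
    then show ?thesis using open_le sub by blast
  next
    case False
    then have "closed B" using B by (simp add: open_or_closed_def)
    show ?thesis
      unfolding DTM_closed_eq_INF[OF \<nu> \<open>closed B\<close>] using open_le sub by (intro INF_greatest) auto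
  qed
qed

lemma DTM_less_top:
  assumes "\<nu> \<in> DTM" "A \<in> open_or_closed"
  shows "\<nu> A < \<infinity>"
proof -
  have "\<nu> A \<le> \<nu> UNIV"
    using assms by (intro DTM_mono) (auto intro: open_or_closedI)
  also have "\<dots> < \<infinity>" using assms(1) by (simp add: DTM_def)
  finally show ?thesis .
qed

lemma DTM_approx_compact:
  fixes e :: real
  assumes \<nu>: "\<nu> \<in> DTM" and U: "open U" and e: "e > 0"
  obtains C where "compact C" "C \<subseteq> U" "\<nu> U \<le> \<nu> C + e"
proof (rule ccontr)
  assume no: "\<not> thesis"
  note witness = that
  have "\<nu> C + e \<le> \<nu> U" if "compact C" "C \<subseteq> U" for C
    using no witness that by (meson linear)
  then have "(SUP C\<in>{C. compact C \<and> C \<subseteq> U}. \<nu> C + e) \<le> \<nu> U"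
    by (intro SUP_least) auto
  then have "\<nu> U + e \<le> \<nu> U"
    using DTM_open_eq_SUP[OF \<nu> U]
    by (subst (asm) ennreal_SUP_add_left) (auto intro: exI[of _ "{}"])
  moreover have "\<nu> U < \<infinity>"
    using DTM_less_top[OF \<nu>] U open_or_closedI by blast
  ultimately show False
    using e by (cases "\<nu> U") (auto simp flip: ennreal_plus)
qed

lemma DTM_approx_open:
  fixes e :: real
  assumes \<nu>: "\<nu> \<in> DTM" and F: "closed F" and e: "e > 0"
  obtains U where "open U" "F \<subseteq> U" "\<nu> U \<le> \<nu> F + e"
proof -
  have "\<nu> F < \<infinity>"
    using DTM_less_top[OF \<nu>] F open_or_closedI by blast
  then have "\<nu> F < \<nu> F + e"
    using e by (cases "\<nu> F") (auto simp flip: ennreal_plus intro!: ennreal_lessI)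
  then have "\<exists>U\<in>{U. open U \<and> F \<subseteq> U}. \<nu> U < \<nu> F + e"
    by (subst (asm) DTM_closed_eq_INF[OF \<nu> F]) (simp only: INF_less_iff)
  then show ?thesis using that by (auto intro: less_imp_le)
qed

text \<open>
  Regularity in the form used to construct examples: for sums and differences, attaining the
  supremum and infimum up to \<open>e\<close> combines well with the estimates at hand. Monotonicity is demanded
  only from closed to open sets, which is what superadditivity gives for a difference \<open>\<nu> - m\<close>.
\<close>

lemma DTM_I:
  fixes \<nu> :: "'a::t2_space set \<Rightarrow> ennreal"
  assumes ext: "\<nu> \<in> extensional open_or_closed"
    and fin: "\<nu> UNIV < \<infinity>"
    and add: "\<And>C K. compact C \<Longrightarrow> compact K \<Longrightarrow> C \<inter> K = {} \<Longrightarrow> \<nu> (C \<union> K) = \<nu> C + \<nu> K"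
    and mono: "\<And>F U. closed F \<Longrightarrow> open U \<Longrightarrow> F \<subseteq> U \<Longrightarrow> \<nu> F \<le> \<nu> U"
    and inner: "\<And>U e. open U \<Longrightarrow> (0::real) < e \<Longrightarrow> \<exists>C. compact C \<and> C \<subseteq> U \<and> \<nu> U \<le> \<nu> C + e"
    and outer: "\<And>F e. closed F \<Longrightarrow> (0::real) < e \<Longrightarrow> \<exists>U. open U \<and> F \<subseteq> U \<and> \<nu> U \<le> \<nu> F + e"
  shows "\<nu> \<in> DTM"
proof -
  have "\<nu> U = (SUP C\<in>{C. compact C \<and> C \<subseteq> U}. \<nu> C)" if "open U" for U
    using that inner by (intro ennreal_approx_SUP) (auto intro: mono compact_imp_closed)
  moreover have "\<nu> F = (INF U\<in>{U. open U \<and> F \<subseteq> U}. \<nu> U)" if "closed F" for F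
    using that outer by (intro ennreal_approx_INF) (auto intro: mono compact_imp_closed)
  moreover have "\<exists>A\<in>open_or_closed. \<nu> A \<noteq> \<infinity>"
    using fin open_or_closedI(1)[OF open_UNIV] by (auto intro!: bexI[of _ UNIV])
  ultimately show ?thesis
    using ext fin add
    by (simp add: DTM_def deficient_topological_measure_def inner_compact_regular_def
        outer_open_regular_def)
qed

text \<open>
  Two inner approximations: \<open>U\<close> is approximated by a compact \<open>D\<close>, and \<open>F\<close> lies in the open set
  \<open>W - D\<close>, which is approximated by compact sets disjoint from \<open>D\<close>. The detour through \<open>W - D\<close>
  replaces a closed set, for which additivity is not postulated, by compact ones.
\<close>

lemma DTM_superadditive:
  assumes \<nu>: "\<nu> \<in> DTM" and F: "closed F" and U: "open U" and W: "open W"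
    and disj: "F \<inter> U = {}" and sub: "F \<union> U \<subseteq> W"
  shows "\<nu> F + \<nu> U \<le> \<nu> W"
proof -
  have "\<nu> F + \<nu> D \<le> \<nu> W" if D: "compact D" "D \<subseteq> U" for D
  proof -
    have "open (W - D)" using W D by (simp add: compact_imp_closed open_Diff)
    have "\<nu> F \<le> \<nu> (W - D)"
      using F disj sub D \<open>open (W - D)\<close> by (intro DTM_mono[OF \<nu>]) (auto intro: open_or_closedI)
    also have "\<nu> (W - D) + \<nu> D \<le> \<nu> W"
    proof -
      have "\<nu> C + \<nu> D \<le> \<nu> W" if C: "compact C" "C \<subseteq> W - D" for C
      proof -
        have "\<nu> C + \<nu> D = \<nu> (C \<union> D)"
          using C D by (intro DTM_additive_compact[OF \<nu>, symmetric]) auto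
        also have "\<dots> \<le> \<nu> W"
          using C D sub W by (intro DTM_mono[OF \<nu>]) (auto intro: open_or_closedI)
        finally show ?thesis .
      qed
      then show ?thesis
        by (subst DTM_open_eq_SUP[OF \<nu> \<open>open (W - D)\<close>], subst ennreal_SUP_add_left[symmetric])
          (auto intro!: SUP_least exI[of _ "{}"])
    qed
    finally show ?thesis by (simp add: add_right_mono)
  qed
  then show ?thesis
    by (subst DTM_open_eq_SUP[OF \<nu> U], subst ennreal_SUP_add_right)
      (auto intro!: SUP_least exI[of _ "{}"])
qed

text \<open>A compact subset of a disjoint union of two open sets is the disjoint union of its two traces,
  and these are compact.\<close>

lemma DTM_additive_open:
  assumes \<nu>: "\<nu> \<in> DTM" and U: "open U" and V: "open V" and disj: "U \<inter> V = {}"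
  shows "\<nu> (U \<union> V) = \<nu> U + \<nu> V"
proof (rule antisym)
  have "\<nu> C \<le> \<nu> U + \<nu> V" if C: "compact C" "C \<subseteq> U \<union> V" for C
  proof -
    have eq: "C = (C - V) \<union> (C - U)" using disj by blast
    have cpt: "compact (C - V)" "compact (C - U)" using C U V by (auto intro: compact_diff)
    have "\<nu> C = \<nu> (C - V) + \<nu> (C - U)"
      using C cpt by (subst eq, intro DTM_additive_compact[OF \<nu>]) auto
    also have "\<dots> \<le> \<nu> U + \<nu> V"
      using C cpt U V by (intro add_mono DTM_mono[OF \<nu>]) (auto intro: open_or_closedI)
    finally show ?thesis .
  qed
  then show "\<nu> (U \<union> V) \<le> \<nu> U + \<nu> V"
    by (subst DTM_open_eq_SUP[OF \<nu> open_Un[OF U V]]) (auto intro: SUP_least)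
  have "\<nu> C + \<nu> V \<le> \<nu> (U \<union> V)" if "compact C" "C \<subseteq> U" for C
    using that U V disj by (intro DTM_superadditive[OF \<nu>]) (auto intro: compact_imp_closed)
  then show "\<nu> U + \<nu> V \<le> \<nu> (U \<union> V)"
    by (subst DTM_open_eq_SUP[OF \<nu> U], subst ennreal_SUP_add_left[symmetric])
      (auto intro!: SUP_least exI[of _ "{}"])
qed

text \<open>
  The additivity axiom of a topological measure covers several combinations of compact and open
  sets. A deficient topological measure already satisfies it for two sets of the same kind, so the
  mixed cases remain, and they all follow from splitting an open set along a compact subset.
\<close>

lemma DTM_topological_measure_iff:
  assumes \<nu>: "\<nu> \<in> DTM"
  shows "topological_measure \<nu> \<longleftrightarrow>
    (\<forall>C U. compact C \<longrightarrow> open U \<longrightarrow> C \<subseteq> U \<longrightarrow> \<nu> U = \<nu> C + \<nu> (U - C))"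
proof
  assume tm: "topological_measure \<nu>"
  then have add: "\<nu> (A \<union> B) = \<nu> A + \<nu> B"
    if "compact A" "open B" "open (A \<union> B)" "A \<inter> B = {}" for A B
    using that unfolding topological_measure_def by blast
  show "\<forall>C U. compact C \<longrightarrow> open U \<longrightarrow> C \<subseteq> U \<longrightarrow> \<nu> U = \<nu> C + \<nu> (U - C)"
  proof (intro allI impI)
    fix C U :: "'a set"
    assume "compact C" "open U" "C \<subseteq> U"
    moreover from this have "C \<union> (U - C) = U" "open (U - C)"
      by (auto simp: compact_imp_closed open_Diff)
    ultimately show "\<nu> U = \<nu> C + \<nu> (U - C)"
      using add[of C "U - C"] by auto
  qed
next
  assume split: "\<forall>C U. compact C \<longrightarrow> open U \<longrightarrow> C \<subseteq> U \<longrightarrow> \<nu> U = \<nu> C + \<nu> (U - C)"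
  have open_case: "\<nu> (C \<union> B) = \<nu> C + \<nu> B"
    if "compact C" "open (C \<union> B)" "C \<inter> B = {}" for C B
  proof -
    have "C \<union> B - C = B" using that(3) by blast
    then show ?thesis using split that by (metis Un_upper1)
  qed
  \<comment> \<open>If \<open>C \<union> B\<close> is compact, \<open>C\<close> is enlarged to an open set \<open>V\<close>. Then \<open>V \<union> B\<close> is open and
      splits into the compact set \<open>B - V\<close> and the remainder, which is \<open>V\<close>.\<close>
  have compact_case: "\<nu> (C \<union> B) = \<nu> C + \<nu> B"
    if C: "compact C" and B: "open B" and K: "compact (C \<union> B)" and disj: "C \<inter> B = {}" for C B
  proof (rule antisym)
    show "\<nu> (C \<union> B) \<le> \<nu> C + \<nu> B"
    proof (rule ennreal_le_epsilon)
      fix e :: real assume "e > 0"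
      then obtain V where V: "open V" "C \<subseteq> V" "\<nu> V \<le> \<nu> C + e"
        using DTM_approx_open[OF \<nu> compact_imp_closed[OF C]] by blast
      have eq: "C \<union> B - V = B - V" using V by blast
      have cpt: "compact (B - V)"
        using compact_diff[OF K V(1)] unfolding eq .
      have "\<nu> (C \<union> B) \<le> \<nu> (V \<union> B)"
        using V B K by (intro DTM_mono[OF \<nu>]) (auto intro: open_or_closedI)
      also have "\<dots> = \<nu> (B - V) + \<nu> (V \<union> B - (B - V))"
        using split V B cpt by blast
      also have "V \<union> B - (B - V) = V" by blast
      also have "\<nu> (B - V) \<le> \<nu> B"
        using cpt B by (intro DTM_mono[OF \<nu>]) (auto intro: open_or_closedI)
      also note V(3)
      finally show "\<nu> (C \<union> B) \<le> \<nu> C + \<nu> B + e"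
        by (simp add: ac_simps add_mono)
    qed
    have "\<nu> C + \<nu> D \<le> \<nu> (C \<union> B)" if D: "compact D" "D \<subseteq> B" for D
    proof -
      have "\<nu> C + \<nu> D = \<nu> (C \<union> D)"
        using C D disj by (intro DTM_additive_compact[OF \<nu>, symmetric]) auto
      also have "\<dots> \<le> \<nu> (C \<union> B)"
        using C D K by (intro DTM_mono[OF \<nu>]) (auto intro: open_or_closedI)
      finally show ?thesis .
    qed
    then show "\<nu> C + \<nu> B \<le> \<nu> (C \<union> B)"
      by (subst DTM_open_eq_SUP[OF \<nu> B], subst ennreal_SUP_add_right)
        (auto intro!: SUP_least exI[of _ "{}"])
  qed
  have mixed: "\<nu> (C \<union> B) = \<nu> C + \<nu> B"
    if "compact C" "open B" "compact (C \<union> B) \<or> open (C \<union> B)" "C \<inter> B = {}" for C B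
    using that open_case compact_case by blast
  have "\<nu> (A \<union> B) = \<nu> A + \<nu> B"
    if "compact A \<or> open A" "compact B \<or> open B" "compact (A \<union> B) \<or> open (A \<union> B)" "A \<inter> B = {}"
    for A B
    using that mixed[of A B] mixed[of B A] DTM_additive_compact[OF \<nu>, of A B]
      DTM_additive_open[OF \<nu>, of A B]
    by (auto simp: Un_commute Int_commute add.commute)
  then show "topological_measure \<nu>"
    using \<nu> by (auto simp: DTM_def deficient_topological_measure_def topological_measure_def)
qed

lemma zero_in_DTM: "(\<lambda>A. if A \<in> open_or_closed then 0 else undefined) \<in> DTM" (is "?z \<in> _")
proof (rule DTM_I)
  have zero: "?z A = 0" if "open A \<or> compact A \<or> closed A" for A
    using that by (auto intro: open_or_closedI)
  show "?z \<in> extensional open_or_closed" by (simp add: extensional_def)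
  show "?z UNIV < \<infinity>" by (simp add: zero)
  show "?z (C \<union> K) = ?z C + ?z K" if "compact C" "compact K" for C K
    using that by (simp add: open_or_closedI compact_Un)
  show "?z F \<le> ?z U" if "closed F" "open U" for F U
    using that by (simp add: open_or_closedI)
  show "\<exists>C. compact C \<and> C \<subseteq> U \<and> ?z U \<le> ?z C + e" if "open U" for U and e :: real
    using that zero by (intro exI[of _ "{}"]) simp
  show "\<exists>U. open U \<and> F \<subseteq> U \<and> ?z U \<le> ?z F + e" if "closed F" for F and e :: real
    using that zero by (intro exI[of _ UNIV]) simp
qed

lemma topological_measure_if_zero:
  assumes \<nu>: "\<nu> \<in> DTM" and zero: "\<And>A. A \<in> open_or_closed \<Longrightarrow> \<nu> A = 0"
  shows "topological_measure \<nu>"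
  unfolding DTM_topological_measure_iff[OF \<nu>]
  by (simp add: zero open_or_closedI open_Diff compact_imp_closed)

section \<open>Functions vanishing at infinity and integrals over level sets\<close>

lemma C0_plusD:
  assumes "f \<in> C0_plus"
  shows "continuous_on UNIV f" "0 \<le> f x"
  using assms by (auto simp: C0_plus_def)

lemma C0_plus_vanishing:
  assumes "f \<in> C0_plus" "e > 0"
  obtains K where "compact K" "\<And>x. x \<notin> K \<Longrightarrow> f x < e"
  using assms by (auto simp: C0_plus_def)

lemma C0_plus_compact_superlevel:
  assumes f: "f \<in> C0_plus" and s: "s > 0"
  shows "compact (f -` {s..})"
proof -
  obtain K where K: "compact K" "\<And>x. x \<notin> K \<Longrightarrow> f x < s"
    using C0_plus_vanishing[OF f s] by blast
  have "closed (f -` {s..})"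
    using C0_plusD(1)[OF f] by (intro closed_vimage) auto
  moreover have "f -` {s..} \<subseteq> K"
    using K(2) by force
  ultimately show ?thesis
    using K(1) compact_Int_closed[of K "f -` {s..}"] by (simp add: Int_absorb1)
qed

lemma C0_plus_open_superlevel:
  assumes "f \<in> C0_plus"
  shows "open (f -` {t<..})"
  using C0_plusD(1)[OF assms] by (intro open_vimage) auto

lemma C0_plus_superlevel_open_or_closed:
  assumes "f \<in> C0_plus"
  shows "f -` {t<..} \<in> open_or_closed" "f -` {t..} \<in> open_or_closed"
  using C0_plus_open_superlevel[OF assms] closed_vimage[OF _ C0_plusD(1)[OF assms], of "{t..}"]
  by (simp_all add: open_or_closed_def)

lemma C0_plus_bounded:
  assumes f: "f \<in> C0_plus"
  obtains b where "range f \<subseteq> {0..b}"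
proof -
  obtain K where K: "compact K" "\<And>x. x \<notin> K \<Longrightarrow> f x < 1"
    using C0_plus_vanishing[OF f zero_less_one] by blast
  have "compact (f ` K)"
    using K(1) C0_plusD(1)[OF f] by (auto intro: compact_continuous_image continuous_on_subset)
  then have "bdd_above (f ` K)"
    by (intro bounded_imp_bdd_above compact_imp_bounded)
  then obtain B where B: "\<And>x. x \<in> K \<Longrightarrow> f x \<le> B"
    by (auto simp: bdd_above_def)
  have "f x \<le> max 1 B" for x
    using K(2)[of x] B[of x] by (cases "x \<in> K") auto
  then show ?thesis
    using C0_plusD(2)[OF f] by (intro that[of "max 1 B"]) auto
qed

lemma C0_plus_dominated:
  assumes "continuous_on UNIV f" "\<And>x. 0 \<le> f x" "\<And>x. f x \<le> g x" "g \<in> C0_plus"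
  shows "f \<in> C0_plus"
  unfolding C0_plus_def
proof (intro CollectI conjI allI impI assms(1,2))
  fix e :: real assume "e > 0"
  then obtain K where "compact K" "\<And>x. x \<notin> K \<Longrightarrow> g x < e"
    using C0_plus_vanishing[OF assms(4)] by blast
  then show "\<exists>K. compact K \<and> (\<forall>x. x \<notin> K \<longrightarrow> f x < e)"
    using assms(3) by (meson order.strict_trans1)
qed

text \<open>The Urysohn function is taken with respect to the part of \<open>U\<close> inside a relatively compact
  neighbourhood \<open>V\<close> of \<open>K\<close>, so that it has compact support and thus vanishes at infinity.\<close>

lemma Urysohn_C0_plus:
  fixes K U :: "'a::t2_space set"
  assumes lc: "locally_compact_space (euclidean :: 'a topology)"
    and K: "compact K" and U: "open U" and sub: "K \<subseteq> U"
  obtains f where "f \<in> C0_plus" "\<And>x. f x \<le> 1" "\<And>x. x \<in> K \<Longrightarrow> f x = 1" "\<And>x. x \<notin> U \<Longrightarrow> f x = 0"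
proof -
  have haus: "Hausdorff_space (euclidean :: 'a topology)"
    by (auto simp: Hausdorff_space_def disjnt_def separation_t2)
  obtain V L where VL: "open V" "compact L" "K \<subseteq> V" "V \<subseteq> L"
    using lc K locally_compact_space_compact_closed_compact[of "euclidean :: 'a topology"] haus
    by auto
  have cr: "completely_regular_space (euclidean :: 'a topology)"
    using lc haus by (intro locally_compact_regular_imp_completely_regular_space) auto
  obtain f where f: "continuous_map (euclidean :: 'a topology) (top_of_set {0..1::real}) f"
      "f ` (- (U \<inter> V)) \<subseteq> {0}" "f ` K \<subseteq> {1}"
    using U VL K sub cr
    by (rule_tac Urysohn_completely_regular_compact_closed[of 0 1 euclidean K "- (U \<inter> V)"])
      (auto simp: disjnt_def)
  have cont: "continuous_on UNIV f" and range: "f x \<in> {0..1}" for x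
    using f(1) by (auto simp: continuous_map_in_subtopology)
  have zero: "f x = 0" if "x \<notin> U \<inter> V" for x
    using f(2) that by blast
  have "f \<in> C0_plus"
    unfolding C0_plus_def
  proof (intro CollectI conjI allI impI cont)
    show "0 \<le> f x" for x using range[of x] by simp
    show "\<exists>K. compact K \<and> (\<forall>x. x \<notin> K \<longrightarrow> f x < e)" if "e > 0" for e
      using VL(2,4) zero that by (intro exI[of _ L]) (metis IntD2 subsetD)
  qed
  moreover have "f x \<le> 1" for x using range[of x] by simp
  ultimately show ?thesis
    using f(3) zero by (intro that[of f]) auto
qed

lemma antimono_set_integrable:
  fixes H :: "real \<Rightarrow> real"
  assumes "antimono H" and "\<And>t. 0 \<le> H t" and "\<And>t. H t \<le> B"
  shows "set_integrable lborel {0..b} H"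
proof -
  have "(\<lambda>t. - H t) \<in> borel_measurable borel"
    using assms(1) by (intro borel_measurable_mono) (auto simp: mono_def antimono_def)
  then have [measurable]: "H \<in> borel_measurable borel"
    using borel_measurable_uminus[of "\<lambda>t. - H t"] by simp
  show ?thesis
    unfolding set_integrable_def using assms(2,3)
    by (intro integrableI_bounded_set_indicator[where B = B])
      (auto simp: abs_of_nonneg emeasure_lborel_Icc_eq)
qed

lemma DTM_real_mono:
  assumes "\<nu> \<in> DTM" "A \<in> open_or_closed" "B \<in> open_or_closed" "A \<subseteq> B"
  shows "enn2real (\<nu> A) \<le> enn2real (\<nu> B)"
  using DTM_mono[OF assms] DTM_less_top[OF assms(1,3)] by (simp add: enn2real_mono)

lemma DTM_antimono_upper_level:
  assumes \<nu>: "\<nu> \<in> DTM" and f: "f \<in> C0_plus"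
  shows "antimono (\<lambda>t. enn2real (\<nu> (f -` {t<..})))"
  by (intro antimonoI DTM_real_mono[OF \<nu>] C0_plus_superlevel_open_or_closed[OF f]) auto

lemma DTM_antimono_closed_level:
  assumes \<nu>: "\<nu> \<in> DTM" and f: "f \<in> C0_plus"
  shows "antimono (\<lambda>t. enn2real (\<nu> (f -` {t..})))"
  by (intro antimonoI DTM_real_mono[OF \<nu>] C0_plus_superlevel_open_or_closed[OF f]) auto

lemma DTM_level_integrable:
  assumes \<nu>: "\<nu> \<in> DTM" and f: "f \<in> C0_plus"
  shows "set_integrable lborel {0..b} (\<lambda>t. enn2real (\<nu> (f -` {t<..})))"
  by (intro antimono_set_integrable[where B = "enn2real (\<nu> UNIV)"] DTM_antimono_upper_level[OF \<nu> f]
      DTM_real_mono[OF \<nu>] C0_plus_superlevel_open_or_closed[OF f] open_or_closed_openI) auto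

lemma DTM_closed_level_integrable:
  assumes \<nu>: "\<nu> \<in> DTM" and f: "f \<in> C0_plus"
  shows "set_integrable lborel {0..b} (\<lambda>t. enn2real (\<nu> (f -` {t..})))"
  by (intro antimono_set_integrable[where B = "enn2real (\<nu> UNIV)"] DTM_antimono_closed_level[OF \<nu> f]
      DTM_real_mono[OF \<nu>] C0_plus_superlevel_open_or_closed[OF f] open_or_closed_openI) auto

text \<open>
  The open and the closed superlevel sets have monotone value functions \<open>H \<le> G\<close> which interlace,
  \<open>G t \<le> H s\<close> for \<open>s < t\<close>. They agree wherever \<open>H\<close> is continuous, that is, outside a countable set.
\<close>

lemma DTM_level_AE_eq:
  assumes \<nu>: "\<nu> \<in> DTM" and f: "f \<in> C0_plus"
  shows "AE t in lborel. enn2real (\<nu> (f -` {t..})) = enn2real (\<nu> (f -` {t<..}))"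
proof -
  define H G where "H = (\<lambda>t. enn2real (\<nu> (f -` {t<..})))" and "G = (\<lambda>t. enn2real (\<nu> (f -` {t..})))"
  note ooc = C0_plus_superlevel_open_or_closed[OF f]
  have HG: "H t \<le> G t" for t
    unfolding H_def G_def by (intro DTM_real_mono[OF \<nu>] ooc) auto
  have GH: "G t \<le> H s" if "s < t" for s t
    unfolding H_def G_def using that by (intro DTM_real_mono[OF \<nu>] ooc) auto
  have "G t = H t" if "isCont (\<lambda>t. - H t) t" for t
  proof -
    have "isCont H t"
      using isCont_minus[OF that] by simp
    then have "(H \<longlongrightarrow> H t) (at_left t)"
      by (simp add: isCont_def filterlim_at_split)
    then have "G t \<le> H t"
      using GH by (intro tendsto_lowerbound[where F = "at_left t" and f = H])
        (auto simp: eventually_at_left_field intro!: exI[of _ "t - 1"])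
    then show ?thesis using HG[of t] by simp
  qed
  then have "{t. G t \<noteq> H t} \<subseteq> {t. \<not> isCont (\<lambda>t. - H t) t}" by blast
  moreover have "countable {t. \<not> isCont (\<lambda>t. - H t) t}"
    using DTM_antimono_upper_level[OF \<nu> f]
    by (intro mono_ctble_discont) (auto simp: mono_def antimono_def H_def)
  ultimately have "countable {t. G t \<noteq> H t}" by (rule countable_subset)
  then have "AE t in lborel. t \<notin> {t. G t \<noteq> H t}"
    by (intro AE_not_in countable_imp_null_set_lborel)
  then show ?thesis by (simp add: G_def H_def)
qed

text \<open>
  The form of the integral in which \<open>g\<close> enters the splitting of level sets in
  \<open>TM_integral_subadditive\<close>: there the compact part removed from the superlevel set of \<open>h\<close>
  at height \<open>t\<close> is the closed superlevel set of \<open>g\<close> at height \<open>1 - t\<close>.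
\<close>

lemma dtm_integral_eq_reflected_closed:
  assumes \<nu>: "\<nu> \<in> DTM" and f: "f \<in> C0_plus" and le1: "\<And>x. f x \<le> 1"
  shows "set_integrable lborel {0..1} (\<lambda>t. enn2real (\<nu> (f -` {1 - t..})))"
    and "(LBINT t:{0..1}. enn2real (\<nu> (f -` {1 - t..}))) = dtm_integral \<nu> f"
proof -
  define G where "G = (\<lambda>t. enn2real (\<nu> (f -` {t..})))"
  have int: "set_integrable lborel {0..1} G"
    unfolding G_def by (rule DTM_closed_level_integrable[OF \<nu> f])
  have refl: "indicator {0..1} (1 + - 1 * t) *\<^sub>R G (1 + - 1 * t) = indicator {0..1} t *\<^sub>R G (1 - t)"
    for t :: real
    by (auto simp: indicator_def)
  have "integrable lborel (\<lambda>t. indicator {0..1} (1 + - 1 * t) *\<^sub>R G (1 + - 1 * t))"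
    using int unfolding set_integrable_def by (intro lborel_integrable_real_affine) auto
  then show "set_integrable lborel {0..1} (\<lambda>t. enn2real (\<nu> (f -` {1 - t..})))"
    unfolding refl by (simp add: set_integrable_def G_def)
  have "(LBINT t:{0..1}. G (1 - t)) = (LBINT t:{0..1}. G t)"
    unfolding set_lebesgue_integral_def
    using lborel_integral_real_affine[of "- 1" "\<lambda>t. indicator {0..1} t *\<^sub>R G t" 1]
    unfolding refl by simp
  also have "\<dots> = (LBINT t:{0..1}. enn2real (\<nu> (f -` {t<..})))"
    using int DTM_level_integrable[OF \<nu> f, of 1] DTM_level_AE_eq[OF \<nu> f]
    unfolding set_lebesgue_integral_def set_integrable_def G_def
    by (intro integral_cong_AE borel_measurable_integrable) auto
  also have "\<dots> = dtm_integral \<nu> f"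
    using C0_plusD(2)[OF f] le1 by (intro dtm_integral_eq[OF \<nu>, symmetric]) auto
  finally show "(LBINT t:{0..1}. enn2real (\<nu> (f -` {1 - t..}))) = dtm_integral \<nu> f"
    by (simp add: G_def)
qed

lemma dtm_integral_bounds:
  assumes \<nu>: "\<nu> \<in> DTM" and f: "f \<in> C0_plus" and le1: "\<And>x. f x \<le> 1"
  shows "(\<And>t. 0 < t \<Longrightarrow> t < 1 \<Longrightarrow> a \<le> enn2real (\<nu> (f -` {t<..}))) \<Longrightarrow> a \<le> dtm_integral \<nu> f"
    and "(\<And>t. 0 < t \<Longrightarrow> t < 1 \<Longrightarrow> enn2real (\<nu> (f -` {t<..})) \<le> a) \<Longrightarrow> dtm_integral \<nu> f \<le> a"
proof -
  have eq: "dtm_integral \<nu> f = (LBINT t:{0..1}. enn2real (\<nu> (f -` {t<..})))"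
    using C0_plusD(2)[OF f] le1 by (intro dtm_integral_eq[OF \<nu>]) auto
  have ends: "AE t in lborel. t \<noteq> (0::real)" "AE t in lborel. t \<noteq> (1::real)"
    by (rule AE_lborel_singleton)+
  have const: "set_integrable lborel {0..1} (\<lambda>t::real. a)" "(LBINT t:{0..1::real}. a) = a"
    by (simp_all add: set_integrable_def set_lebesgue_integral_def)
  show "a \<le> dtm_integral \<nu> f" if "\<And>t. 0 < t \<Longrightarrow> t < 1 \<Longrightarrow> a \<le> enn2real (\<nu> (f -` {t<..}))"
  proof -
    have "AE t\<in>{0..1} in lborel. a \<le> enn2real (\<nu> (f -` {t<..}))"
      using ends by eventually_elim (auto intro: that)
    then have "(LBINT t:{0..1::real}. a) \<le> dtm_integral \<nu> f"
      unfolding eq by (intro set_integral_mono_AE const DTM_level_integrable[OF \<nu> f]) auto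
    then show ?thesis using const by simp
  qed
  show "dtm_integral \<nu> f \<le> a" if "\<And>t. 0 < t \<Longrightarrow> t < 1 \<Longrightarrow> enn2real (\<nu> (f -` {t<..})) \<le> a"
  proof -
    have "AE t\<in>{0..1} in lborel. enn2real (\<nu> (f -` {t<..})) \<le> a"
      using ends by eventually_elim (auto intro: that)
    then have "dtm_integral \<nu> f \<le> (LBINT t:{0..1::real}. a)"
      unfolding eq by (intro set_integral_mono_AE const DTM_level_integrable[OF \<nu> f]) auto
    then show ?thesis using const by simp
  qed
qed

section \<open>Topological measures form a weakly closed set\<close>

text \<open>
  A topological measure integrates linearly on the functions of one fixed function, here
  \<open>g + h\<close>. Only the instance \<open>h = g + (h - g)\<close> is needed, and there linearity is visible on level
  sets: \<open>{h > t}\<close> is the disjoint union of the compact set \<open>{g \<ge> 1 - t}\<close> and the open set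
  \<open>{h - g > t}\<close>, since \<open>h - g\<close> equals \<open>1 - g\<close> where \<open>g > 0\<close> and equals \<open>h\<close> elsewhere.
\<close>

lemma TM_integral_subadditive:
  assumes \<mu>: "\<mu> \<in> TM" and h: "h \<in> C0_plus" and g: "g \<in> C0_plus"
    and h1: "\<And>x. h x \<le> 1" and g1: "\<And>x. g x \<le> 1" and one: "\<And>x. g x > 0 \<Longrightarrow> h x = 1"
    and k: "(\<lambda>x. h x - g x) \<in> C0_plus"
  shows "dtm_integral \<mu> h \<le> dtm_integral \<mu> g + dtm_integral \<mu> (\<lambda>x. h x - g x)"
proof -
  define k where "k = (\<lambda>x. h x - g x)"
  have \<mu>D: "\<mu> \<in> DTM" and \<mu>T: "topological_measure \<mu>"
    using \<mu> TM_subset_DTM by (auto simp: TM_def)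
  have kC: "k \<in> C0_plus" using k by (simp add: k_def)
  have k1: "k x \<le> 1" for x using h1[of x] C0_plusD(2)[OF g, of x] by (simp add: k_def)
  note h0 = C0_plusD(2)[OF h] and g0 = C0_plusD(2)[OF g] and k0 = C0_plusD(2)[OF kC]
  note ooc = C0_plus_superlevel_open_or_closed
  have "enn2real (\<mu> (h -` {t<..})) \<le> enn2real (\<mu> (g -` {1 - t..})) + enn2real (\<mu> (k -` {t<..}))"
    if t: "0 \<le> t" "t \<le> 1" for t
    \<comment> \<open>At \<open>t = 1\<close> the set \<open>{g \<ge> 1 - t}\<close> need not be compact, but there the left-hand side is \<open>0\<close>.\<close>
  proof (cases "t = 1")
    case True
    then have "h -` {t<..} = {}" using h1 by (auto simp: not_less[symmetric])
    then show ?thesis by (simp add: DTM_empty[OF \<mu>D])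
  next
    case False
    then have t1: "t < 1" using t by simp
    have sub: "g -` {1 - t..} \<subseteq> h -` {t<..}"
      using one t1 by force
    have diff: "h -` {t<..} - g -` {1 - t..} = k -` {t<..}"
    proof (intro set_eqI)
      fix x
      show "x \<in> h -` {t<..} - g -` {1 - t..} \<longleftrightarrow> x \<in> k -` {t<..}"
        using one[of x] g0[of x] t t1 by (cases "g x > 0") (auto simp: k_def not_le)
    qed
    have "\<mu> (h -` {t<..}) = \<mu> (g -` {1 - t..}) + \<mu> (k -` {t<..})"
      using \<mu>T[unfolded DTM_topological_measure_iff[OF \<mu>D], rule_format,
          OF C0_plus_compact_superlevel[OF g] C0_plus_open_superlevel[OF h] sub] t1 diff by simp
    then show ?thesis
      using DTM_less_top[OF \<mu>D ooc(2)[OF g, of "1 - t"]] DTM_less_top[OF \<mu>D ooc(1)[OF kC, of t]]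
      by (simp add: enn2real_plus)
  qed
  note le = this
  note int = dtm_integral_eq_reflected_closed(1)[OF \<mu>D g g1] DTM_level_integrable[OF \<mu>D kC, of 1]
  have "dtm_integral \<mu> h = (LBINT t:{0..1}. enn2real (\<mu> (h -` {t<..})))"
    using h0 h1 by (intro dtm_integral_eq[OF \<mu>D]) auto
  also have "\<dots> \<le> (LBINT t:{0..1}. enn2real (\<mu> (g -` {1 - t..})) + enn2real (\<mu> (k -` {t<..})))"
    using le by (intro set_integral_mono set_integral_add(1) int DTM_level_integrable[OF \<mu>D h]) auto
  also have "\<dots> = dtm_integral \<mu> g + (LBINT t:{0..1}. enn2real (\<mu> (k -` {t<..})))"
    by (simp add: set_integral_add(2)[OF int] dtm_integral_eq_reflected_closed(2)[OF \<mu>D g g1])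
  also have "(LBINT t:{0..1}. enn2real (\<mu> (k -` {t<..}))) = dtm_integral \<mu> k"
    using k0 k1 by (intro dtm_integral_eq[OF \<mu>D, symmetric]) auto
  finally show ?thesis by (simp add: k_def)
qed

lemma non_TM_compact_open_gap:
  assumes \<nu>: "\<nu> \<in> DTM" and no: "\<not> topological_measure \<nu>"
  obtains C U where "compact C" "open U" "C \<subseteq> U"
    "enn2real (\<nu> C) + enn2real (\<nu> (U - C)) < enn2real (\<nu> U)"
proof -
  obtain C U where CU: "compact C" "open U" "C \<subseteq> U" and ne: "\<nu> U \<noteq> \<nu> C + \<nu> (U - C)"
    using no DTM_topological_measure_iff[OF \<nu>] by blast
  have op: "open (U - C)" using CU by (simp add: open_Diff compact_imp_closed)
  have "\<nu> C + \<nu> (U - C) \<le> \<nu> U"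
    using CU op by (intro DTM_superadditive[OF \<nu>]) (auto simp: compact_imp_closed)
  with ne have "\<nu> C + \<nu> (U - C) < \<nu> U" by simp
  moreover have "\<nu> C < \<infinity>" "\<nu> (U - C) < \<infinity>" "\<nu> U < \<infinity>"
    using CU op by (blast intro: DTM_less_top[OF \<nu>] open_or_closedI)+
  ultimately have "enn2real (\<nu> C) + enn2real (\<nu> (U - C)) < enn2real (\<nu> U)"
    by (simp add: enn2real_plus[symmetric] enn2real_less_iff)
  with CU show ?thesis by (rule that)
qed

text \<open>
  Around the compact set \<open>C\<close> of the gap, \<open>g\<close> is concentrated on a neighbourhood \<open>V\<close> with
  \<open>\<nu>(V)\<close> close to \<open>\<nu>(C)\<close>, and \<open>h\<close> equals \<open>1\<close> on a compact \<open>K\<close> with \<open>\<nu>(K)\<close> close to \<open>\<nu>(U)\<close> and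
  vanishes off \<open>U\<close>. Both are \<open>1\<close> on \<open>C\<close>, so \<open>h - g\<close> is concentrated on \<open>U - C\<close>, and the three
  integrals reproduce the gap up to the errors in the two approximations.
\<close>

lemma non_TM_integral_gap:
  fixes \<nu> :: "'a::t2_space set \<Rightarrow> ennreal"
  assumes lc: "locally_compact_space (euclidean :: 'a topology)"
    and \<nu>: "\<nu> \<in> DTM" and no: "\<not> topological_measure \<nu>"
  obtains h g where "h \<in> C0_plus" "g \<in> C0_plus" "(\<lambda>x. h x - g x) \<in> C0_plus"
    "\<And>x. h x \<le> 1" "\<And>x. g x \<le> 1" "\<And>x. g x > 0 \<Longrightarrow> h x = 1"
    "dtm_integral \<nu> g + dtm_integral \<nu> (\<lambda>x. h x - g x) < dtm_integral \<nu> h"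
proof -
  obtain C U where C: "compact C" and U: "open U" and CU: "C \<subseteq> U"
    and gap: "enn2real (\<nu> C) + enn2real (\<nu> (U - C)) < enn2real (\<nu> U)"
    using non_TM_compact_open_gap[OF \<nu> no] .
  \<comment> \<open>Two errors of size \<open>e\<close> are made, one in \<open>V\<close> and one in \<open>K\<close>; a third of the gap is affordable.\<close>
  define e where "e = (enn2real (\<nu> U) - enn2real (\<nu> C) - enn2real (\<nu> (U - C))) / 3"
  have e: "e > 0" using gap by (simp add: e_def)
  have to_real: "enn2real x \<le> enn2real y + e" if "x \<le> y + ennreal e" "y < \<infinity>" for x y
  proof -
    have "enn2real x \<le> enn2real (y + ennreal e)"
      using that by (intro enn2real_mono) auto
    then show ?thesis using that e by (simp add: enn2real_plus)
  qed
  obtain K where K: "compact K" "K \<subseteq> U" "\<nu> U \<le> \<nu> K + ennreal e"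
    using DTM_approx_compact[OF \<nu> U e] .
  obtain V' where V': "open V'" "C \<subseteq> V'" "\<nu> V' \<le> \<nu> C + ennreal e"
    using DTM_approx_open[OF \<nu> compact_imp_closed[OF C] e] .
  define V where "V = V' \<inter> U"
  have V: "open V" "C \<subseteq> V" "V \<subseteq> U" using V' U CU by (auto simp: V_def)
  have Ve: "enn2real (\<nu> V) \<le> enn2real (\<nu> C) + e"
  proof (rule to_real)
    have "\<nu> V \<le> \<nu> V'"
      using V' V by (intro DTM_mono[OF \<nu>] open_or_closed_openI) (auto simp: V_def)
    also note V'(3)
    finally show "\<nu> V \<le> \<nu> C + ennreal e" .
    show "\<nu> C < \<infinity>" using C by (intro DTM_less_top[OF \<nu>] open_or_closed_compactI)
  qed
  have Ke: "enn2real (\<nu> U) \<le> enn2real (\<nu> K) + e"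
    using K by (intro to_real DTM_less_top[OF \<nu>] open_or_closed_compactI)
  obtain g' where g': "g' \<in> C0_plus" "\<And>x. g' x \<le> 1" "\<And>x. x \<in> C \<Longrightarrow> g' x = 1"
      "\<And>x. x \<notin> V \<Longrightarrow> g' x = 0"
    by (rule Urysohn_C0_plus[OF lc C V(1,2)]) (rule that)
  \<comment> \<open>Cutting \<open>g'\<close> off at height \<open>1/2\<close> makes the resulting \<open>g\<close> vanish off the compact set \<open>L\<close>, on which
      \<open>h\<close> can be required to be \<open>1\<close>.\<close>
  define L where "L = g' -` {1/2..}"
  have L: "compact L" "L \<subseteq> V"
    using C0_plus_compact_superlevel[OF g'(1)] g'(4) by (force simp: L_def)+
  have KL: "compact (K \<union> L)" "K \<union> L \<subseteq> U" using K L V by auto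
  obtain h where h: "h \<in> C0_plus" "\<And>x. h x \<le> 1" "\<And>x. x \<in> K \<union> L \<Longrightarrow> h x = 1"
      "\<And>x. x \<notin> U \<Longrightarrow> h x = 0"
    by (rule Urysohn_C0_plus[OF lc KL(1) U KL(2)]) (rule that)
  define g where "g = (\<lambda>x. max 0 (2 * g' x - 1))"
  have contg: "continuous_on UNIV g"
    unfolding g_def using C0_plusD(1)[OF g'(1)] by (intro continuous_intros)
  have g: "g \<in> C0_plus"
  proof (rule C0_plus_dominated[OF contg _ _ g'(1)])
    show "0 \<le> g x" "g x \<le> g' x" for x
      using C0_plusD(2)[OF g'(1), of x] g'(2)[of x] by (auto simp: g_def)
  qed
  have g1: "g x \<le> 1" for x using g'(2)[of x] by (simp add: g_def)
  have gL: "x \<in> L" if "g x > 0" for x using that by (auto simp: g_def L_def)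
  then have one: "h x = 1" if "g x > 0" for x using h(3) that by blast
  define k where "k = (\<lambda>x. h x - g x)"
  have k: "k \<in> C0_plus"
  proof (rule C0_plus_dominated[OF _ _ _ h(1)])
    show "continuous_on UNIV k"
      unfolding k_def using C0_plusD(1)[OF h(1)] contg by (intro continuous_intros)
    show "0 \<le> k x" for x
      using one[of x] g1[of x] C0_plusD(2)[OF h(1), of x] C0_plusD(2)[OF g, of x]
      by (cases "g x > 0") (auto simp: k_def)
    show "k x \<le> h x" for x using C0_plusD(2)[OF g, of x] by (simp add: k_def)
  qed
  have k1: "k x \<le> 1" for x using h(2)[of x] C0_plusD(2)[OF g, of x] by (simp add: k_def)
  have op: "open (U - C)" using U C by (simp add: open_Diff compact_imp_closed)
  note ooc = C0_plus_superlevel_open_or_closed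
  have hK: "enn2real (\<nu> K) \<le> dtm_integral \<nu> h"
    using h(3) by (intro dtm_integral_bounds(1)[OF \<nu> h(1,2)] DTM_real_mono[OF \<nu>] ooc h(1)
      open_or_closed_compactI K(1)) auto
  have gV: "dtm_integral \<nu> g \<le> enn2real (\<nu> V)"
    using gL L(2) by (intro dtm_integral_bounds(2)[OF \<nu> g g1] DTM_real_mono[OF \<nu>] ooc g
      open_or_closed_openI V(1)) force
  have kUC: "dtm_integral \<nu> k \<le> enn2real (\<nu> (U - C))"
  proof (intro dtm_integral_bounds(2)[OF \<nu> k k1] DTM_real_mono[OF \<nu>] ooc k
      open_or_closed_openI op)
    fix t :: real assume t: "0 < t"
    show "k -` {t<..} \<subseteq> U - C"
    proof
      fix x assume "x \<in> k -` {t<..}"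
      then have kx: "k x > 0" using t by simp
      have "x \<in> U"
        using kx h(4)[of x] C0_plusD(2)[OF g, of x] by (auto simp: k_def)
      moreover have "x \<notin> C"
        using kx g'(3)[of x] h(2)[of x] by (auto simp: k_def g_def)
      ultimately show "x \<in> U - C" by simp
    qed
  qed
  have "3 * e = enn2real (\<nu> U) - enn2real (\<nu> C) - enn2real (\<nu> (U - C))"
    by (simp add: e_def)
  then have "dtm_integral \<nu> g + dtm_integral \<nu> k < dtm_integral \<nu> h"
    using Ve Ke e hK gV kUC by linarith
  then show ?thesis
    using that[of h g] h(1,2) g g1 one k by (simp add: k_def)
qed

lemma closedin_TM:
  assumes lc: "locally_compact_space (euclidean :: 'a::t2_space topology)"
  shows "closedin weak_topology (TM :: ('a set \<Rightarrow> ennreal) set)"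
proof -
  have "\<exists>T. openin weak_topology T \<and> \<nu> \<in> T \<and> T \<subseteq> DTM - TM"
    if "\<nu> \<in> DTM - TM" for \<nu> :: "'a set \<Rightarrow> ennreal"
  proof -
    have \<nu>: "\<nu> \<in> DTM" and no: "\<not> topological_measure \<nu>"
      using that by (auto simp: TM_def DTM_def)
    obtain h g where hg: "h \<in> C0_plus" "g \<in> C0_plus" "(\<lambda>x. h x - g x) \<in> C0_plus"
        "\<And>x. h x \<le> 1" "\<And>x. g x \<le> 1" "\<And>x. g x > 0 \<Longrightarrow> h x = 1"
        "dtm_integral \<nu> g + dtm_integral \<nu> (\<lambda>x. h x - g x) < dtm_integral \<nu> h"
      by (rule non_TM_integral_gap[OF lc \<nu> no]) (rule that)
    define \<Phi> where "\<Phi> = (\<lambda>\<mu>. dtm_integral \<mu> h - (dtm_integral \<mu> g + dtm_integral \<mu> (\<lambda>x. h x - g x)))"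
    have "continuous_map weak_topology euclideanreal \<Phi>"
      unfolding \<Phi>_def
      by (intro continuous_map_diff continuous_map_add continuous_map_dtm_integral hg)
    then have "openin weak_topology {\<mu> \<in> DTM. \<Phi> \<mu> \<in> {0<..}}"
      using openin_continuous_map_preimage[of weak_topology euclideanreal \<Phi> "{0<..}"] by simp
    moreover have "\<nu> \<in> {\<mu> \<in> DTM. \<Phi> \<mu> \<in> {0<..}}"
      using \<nu> hg(7) by (simp add: \<Phi>_def)
    moreover have "{\<mu> \<in> DTM. \<Phi> \<mu> \<in> {0<..}} \<subseteq> DTM - TM"
      using TM_integral_subadditive[OF _ hg(1,2,4,5,6,3)] by (force simp: \<Phi>_def)
    ultimately show ?thesis by blast
  qed
  then have "openin weak_topology (DTM - TM :: ('a set \<Rightarrow> ennreal) set)"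
    by (subst openin_subopen) blast
  then show ?thesis by (simp add: closedin_def TM_subset_DTM)
qed

section \<open>Topological measures have empty weak interior\<close>

text \<open>The value \<open>undefined\<close> off \<open>open_or_closed\<close> keeps the sum extensional; that is also why it
  reduces to \<open>\<mu>\<close> itself, not merely on \<open>open_or_closed\<close>, at \<open>c = 0\<close>.\<close>

definition dtm_add_scaled :: "('a::t2_space set \<Rightarrow> ennreal) \<Rightarrow> real \<Rightarrow> ('a set \<Rightarrow> ennreal) \<Rightarrow> 'a set \<Rightarrow> ennreal"
  where "dtm_add_scaled \<mu> c \<nu> =
    (\<lambda>A. if A \<in> open_or_closed then \<mu> A + ennreal c * \<nu> A else undefined)"

lemma dtm_add_scaled_apply:
  "A \<in> open_or_closed \<Longrightarrow> dtm_add_scaled \<mu> c \<nu> A = \<mu> A + ennreal c * \<nu> A"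
  by (simp add: dtm_add_scaled_def)

lemma dtm_add_scaled_zero:
  assumes "\<mu> \<in> DTM"
  shows "dtm_add_scaled \<mu> 0 \<nu> = \<mu>"
  using assms
  by (auto simp: dtm_add_scaled_def fun_eq_iff DTM_def deficient_topological_measure_def
      extensional_def)

lemma dtm_add_scaled_in_DTM:
  assumes \<mu>: "\<mu> \<in> DTM" and \<nu>: "\<nu> \<in> DTM" and c: "c \<ge> 0"
  shows "dtm_add_scaled \<mu> c \<nu> \<in> DTM"
proof (rule DTM_I)
  let ?\<rho> = "dtm_add_scaled \<mu> c \<nu>"
  show "?\<rho> \<in> extensional open_or_closed"
    by (simp add: dtm_add_scaled_def extensional_def)
  show "?\<rho> UNIV < \<infinity>"
    using DTM_less_top[OF \<mu>, of UNIV] DTM_less_top[OF \<nu>, of UNIV]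
    by (simp add: dtm_add_scaled_apply open_or_closedI ennreal_mult_less_top)
  show "?\<rho> (C \<union> K) = ?\<rho> C + ?\<rho> K" if "compact C" "compact K" "C \<inter> K = {}" for C K
    using that DTM_additive_compact[OF \<mu> that] DTM_additive_compact[OF \<nu> that]
    by (simp add: dtm_add_scaled_apply open_or_closedI compact_Un distrib_left ac_simps)
  show "?\<rho> F \<le> ?\<rho> U" if "closed F" "open U" "F \<subseteq> U" for F U
    using that DTM_mono[OF \<mu> _ _ \<open>F \<subseteq> U\<close>] DTM_mono[OF \<nu> _ _ \<open>F \<subseteq> U\<close>]
    by (simp add: dtm_add_scaled_apply open_or_closedI add_mono mult_left_mono)
  \<comment> \<open>An error of \<open>e / (1 + c)\<close> in each summand costs \<open>e\<close> in total; a common approximating set is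
      the union, respectively the intersection, of those for \<open>\<mu>\<close> and \<open>\<nu>\<close>.\<close>
  have budget: "x + ennreal c * y \<le> x' + ennreal c * y' + ennreal e"
    if "x \<le> x' + ennreal (e / (1 + c))" "y \<le> y' + ennreal (e / (1 + c))" "e > 0" for x y x' y' e
  proof -
    have "x + ennreal c * y
        \<le> (x' + ennreal (e / (1 + c))) + ennreal c * (y' + ennreal (e / (1 + c)))"
      using that by (intro add_mono mult_left_mono) auto
    also have "\<dots> = x' + ennreal c * y' + (ennreal (e / (1 + c)) + ennreal c * ennreal (e / (1 + c)))"
      by (simp add: distrib_left ac_simps)
    also have "ennreal (e / (1 + c)) + ennreal c * ennreal (e / (1 + c))
        = ennreal (e / (1 + c) + c * (e / (1 + c)))"
      using c that(3) by (simp add: ennreal_mult del: times_divide_eq_right)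
    also have "e / (1 + c) + c * (e / (1 + c)) = (1 + c) * (e / (1 + c))"
      by (simp only: distrib_right mult_1)
    also have "\<dots> = e" using c by simp
    finally show ?thesis .
  qed
  show "\<exists>C. compact C \<and> C \<subseteq> U \<and> ?\<rho> U \<le> ?\<rho> C + e" if U: "open U" and e: "e > 0" for U and e :: real
  proof -
    have e': "e / (1 + c) > 0" using c e by simp
    obtain C where C: "compact C" "C \<subseteq> U" "\<mu> U \<le> \<mu> C + ennreal (e / (1 + c))"
      using DTM_approx_compact[OF \<mu> U e'] .
    obtain D where D: "compact D" "D \<subseteq> U" "\<nu> U \<le> \<nu> D + ennreal (e / (1 + c))"
      using DTM_approx_compact[OF \<nu> U e'] .
    have "\<mu> C \<le> \<mu> (C \<union> D)" "\<nu> D \<le> \<nu> (C \<union> D)"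
      using C D by (auto intro!: DTM_mono[OF \<mu>] DTM_mono[OF \<nu>] open_or_closed_compactI)
    then have "\<mu> U \<le> \<mu> (C \<union> D) + ennreal (e / (1 + c))" "\<nu> U \<le> \<nu> (C \<union> D) + ennreal (e / (1 + c))"
      using C(3) D(3) by (meson add_right_mono order_trans)+
    then have "\<mu> U + ennreal c * \<nu> U \<le> \<mu> (C \<union> D) + ennreal c * \<nu> (C \<union> D) + ennreal e"
      by (rule budget) (rule e)
    then show ?thesis
      using C D U
      by (intro exI[of _ "C \<union> D"]) (simp add: dtm_add_scaled_apply open_or_closedI compact_Un)
  qed
  show "\<exists>U. open U \<and> F \<subseteq> U \<and> ?\<rho> U \<le> ?\<rho> F + e" if F: "closed F" and e: "e > 0" for F and e :: real
  proof -
    have e': "e / (1 + c) > 0" using c e by simp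
    obtain U where U: "open U" "F \<subseteq> U" "\<mu> U \<le> \<mu> F + ennreal (e / (1 + c))"
      using DTM_approx_open[OF \<mu> F e'] .
    obtain V where V: "open V" "F \<subseteq> V" "\<nu> V \<le> \<nu> F + ennreal (e / (1 + c))"
      using DTM_approx_open[OF \<nu> F e'] .
    have "\<mu> (U \<inter> V) \<le> \<mu> U" "\<nu> (U \<inter> V) \<le> \<nu> V"
      using U V by (auto intro!: DTM_mono[OF \<mu>] DTM_mono[OF \<nu>] open_or_closed_openI)
    then have "\<mu> (U \<inter> V) \<le> \<mu> F + ennreal (e / (1 + c))" "\<nu> (U \<inter> V) \<le> \<nu> F + ennreal (e / (1 + c))"
      using U(3) V(3) by (meson order_trans)+
    then have "\<mu> (U \<inter> V) + ennreal c * \<nu> (U \<inter> V) \<le> \<mu> F + ennreal c * \<nu> F + ennreal e"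
      by (rule budget) (rule e)
    then show ?thesis
      using U V F
      by (intro exI[of _ "U \<inter> V"]) (simp add: dtm_add_scaled_apply open_or_closedI open_Int)
  qed
qed

lemma dtm_integral_add_scaled:
  assumes \<mu>: "\<mu> \<in> DTM" and \<nu>: "\<nu> \<in> DTM" and c: "c \<ge> 0" and f: "f \<in> C0_plus"
  shows "dtm_integral (dtm_add_scaled \<mu> c \<nu>) f = dtm_integral \<mu> f + c * dtm_integral \<nu> f"
proof -
  obtain b where b: "range f \<subseteq> {0..b}" using C0_plus_bounded[OF f] .
  note ooc = C0_plus_superlevel_open_or_closed(1)[OF f]
  have "enn2real (dtm_add_scaled \<mu> c \<nu> (f -` {t<..}))
      = enn2real (\<mu> (f -` {t<..})) + c * enn2real (\<nu> (f -` {t<..}))" for t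
    using DTM_less_top[OF \<mu> ooc[of t]] DTM_less_top[OF \<nu> ooc[of t]] c
    by (simp add: dtm_add_scaled_apply ooc enn2real_plus enn2real_mult ennreal_mult_less_top)
  then show ?thesis
    unfolding dtm_integral_eq[OF dtm_add_scaled_in_DTM[OF \<mu> \<nu> c] b] dtm_integral_eq[OF \<mu> b]
      dtm_integral_eq[OF \<nu> b]
    using DTM_level_integrable[OF \<mu> f, of b] DTM_level_integrable[OF \<nu> f, of b]
    by (simp add: set_integral_add)
qed

text \<open>The splitting identity of \<open>\<mu> + c \<nu>\<close> minus that of \<open>\<mu>\<close> is \<open>c\<close> times that of \<open>\<nu>\<close>; finiteness of
  \<open>\<mu>\<close> permits the subtraction.\<close>

lemma topological_measure_add_scaled_cancel:
  assumes \<mu>: "\<mu> \<in> TM" and \<nu>: "\<nu> \<in> DTM" and c: "c > 0"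
    and sum: "topological_measure (dtm_add_scaled \<mu> c \<nu>)"
  shows "topological_measure \<nu>"
proof -
  have \<mu>D: "\<mu> \<in> DTM" and \<mu>T: "topological_measure \<mu>"
    using \<mu> TM_subset_DTM by (auto simp: TM_def)
  have \<rho>: "dtm_add_scaled \<mu> c \<nu> \<in> DTM"
    using c by (intro dtm_add_scaled_in_DTM[OF \<mu>D \<nu>]) simp
  have "\<nu> U = \<nu> C + \<nu> (U - C)" if CU: "compact C" "open U" "C \<subseteq> U" for C U
  proof -
    have ooc: "C \<in> open_or_closed" "U \<in> open_or_closed" "U - C \<in> open_or_closed"
      using CU by (auto intro: open_or_closedI simp: open_Diff compact_imp_closed)
    have "\<mu> U + ennreal c * \<nu> U = \<mu> U + ennreal c * (\<nu> C + \<nu> (U - C))"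
      using sum[unfolded DTM_topological_measure_iff[OF \<rho>], rule_format, OF CU]
        \<mu>T[unfolded DTM_topological_measure_iff[OF \<mu>D], rule_format, OF CU] ooc
      by (simp add: dtm_add_scaled_apply distrib_left ac_simps)
    then have "ennreal c * \<nu> U = ennreal c * (\<nu> C + \<nu> (U - C))"
      using DTM_less_top[OF \<mu>D ooc(2)] by (auto simp: ennreal_add_left_cancel)
    then show ?thesis
      using c by (simp add: ennreal_mult_cancel_left)
  qed
  then show ?thesis using DTM_topological_measure_iff[OF \<nu>] by blast
qed

lemma continuous_map_dtm_add_scaled:
  fixes \<mu> \<nu> :: "'a::t2_space set \<Rightarrow> ennreal"
  assumes \<mu>: "\<mu> \<in> DTM" and \<nu>: "\<nu> \<in> DTM"
  shows "continuous_map (top_of_set {0..}) weak_topology (\<lambda>c. dtm_add_scaled \<mu> c \<nu>)"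
  unfolding weak_topology_def
proof (rule continuous_on_generated_topo)
  fix S :: "('a set \<Rightarrow> ennreal) set"
  assume "S \<in> {{\<nu> \<in> DTM. dtm_integral \<nu> f \<in> V} | f V. f \<in> C0_plus \<and> open V}"
  then obtain f V where fV: "f \<in> C0_plus" "open V" and S: "S = {\<nu> \<in> DTM. dtm_integral \<nu> f \<in> V}"
    by blast
  have "(\<lambda>c. dtm_add_scaled \<mu> c \<nu>) -` S \<inter> topspace (top_of_set {0..})
      = {0..} \<inter> (\<lambda>c. dtm_integral \<mu> f + c * dtm_integral \<nu> f) -` V"
    using dtm_integral_add_scaled[OF \<mu> \<nu> _ fV(1)] dtm_add_scaled_in_DTM[OF \<mu> \<nu>] by (auto simp: S)
  moreover have "openin (top_of_set {0..})
      ({0..} \<inter> (\<lambda>c. dtm_integral \<mu> f + c * dtm_integral \<nu> f) -` V)"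
    using fV(2) by (intro continuous_openin_preimage_gen continuous_intros)
  ultimately show "openin (top_of_set {0..})
      ((\<lambda>c. dtm_add_scaled \<mu> c \<nu>) -` S \<inter> topspace (top_of_set {0..}))"
    by simp
next
  show "(\<lambda>c. dtm_add_scaled \<mu> c \<nu>) ` topspace (top_of_set {0..})
      \<subseteq> \<Union> {{\<nu> \<in> DTM. dtm_integral \<nu> f \<in> V} | f V. f \<in> C0_plus \<and> open V}"
    unfolding topology_generated_by_topspace[symmetric] weak_topology_def[symmetric]
    using dtm_add_scaled_in_DTM[OF \<mu> \<nu>] by auto
qed

text \<open>
  A weakly open set of topological measures containing \<open>\<mu>\<close> would contain \<open>\<mu> + c \<nu>\<close> for some
  \<open>c > 0\<close>, which is impossible if \<open>\<nu>\<close> is not a topological measure.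
\<close>

lemma nowhere_dense_TM:
  fixes \<nu> :: "'a::t2_space set \<Rightarrow> ennreal"
  assumes lc: "locally_compact_space (euclidean :: 'a topology)"
    and \<nu>: "\<nu> \<in> DTM" and no: "\<not> topological_measure \<nu>"
  shows "nowhere_dense_in weak_topology (TM :: ('a set \<Rightarrow> ennreal) set)"
proof -
  have "\<mu> \<notin> W" if W: "openin weak_topology W" "W \<subseteq> TM" for W and \<mu> :: "'a set \<Rightarrow> ennreal"
  proof
    assume "\<mu> \<in> W"
    then have \<mu>: "\<mu> \<in> TM" and \<mu>D: "\<mu> \<in> DTM" using W(2) TM_subset_DTM by auto
    let ?P = "{c \<in> {0..}. dtm_add_scaled \<mu> c \<nu> \<in> W}"
    have "openin (top_of_set {0..}) ?P"
      using openin_continuous_map_preimage[OF continuous_map_dtm_add_scaled[OF \<mu>D \<nu>] W(1)] by simp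
    moreover have "0 \<in> ?P"
      using \<open>\<mu> \<in> W\<close> by (simp add: dtm_add_scaled_zero[OF \<mu>D])
    ultimately obtain e where e: "e > 0" "ball 0 e \<inter> {0..} \<subseteq> ?P"
      unfolding openin_contains_ball by blast
    then have "e / 2 \<in> ?P" by (intro subsetD[OF e(2)]) auto
    then have "topological_measure (dtm_add_scaled \<mu> (e / 2) \<nu>)"
      using W(2) by (auto simp: TM_def)
    then show False
      using topological_measure_add_scaled_cancel[OF \<mu> \<nu>, of "e / 2"] e no by simp
  qed
  then show ?thesis
    unfolding nowhere_dense_in_def closure_of_closedin[OF closedin_TM[OF lc]] interior_of_def
    by blast
qed

section \<open>Splitting off a maximal measure\<close>

lemma emeasure_sum_exists:
  fixes M N :: "'a measure"
  assumes [measurable_cong]: "sets M = sets N"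
  obtains S where "sets S = sets M" "\<And>A. A \<in> sets M \<Longrightarrow> emeasure S A = emeasure M A + emeasure N A"
proof
  let ?\<mu> = "\<lambda>A. emeasure M A + emeasure N A"
  let ?S = "measure_of (space M) (sets M) ?\<mu>"
  show "sets ?S = sets M" by simp
  have "countably_additive (sets M) ?\<mu>"
  proof (rule countably_additiveI)
    fix A :: "nat \<Rightarrow> 'a set"
    assume A: "range A \<subseteq> sets M" "disjoint_family A" "(\<Union>i. A i) \<in> sets M"
    have "(\<Sum>i. emeasure M (A i) + emeasure N (A i)) = (\<Sum>i. emeasure M (A i)) + (\<Sum>i. emeasure N (A i))"
      by (rule suminf_add[symmetric]) auto
    then show "(\<Sum>i. emeasure M (A i) + emeasure N (A i)) = ?\<mu> (\<Union>i. A i)"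
      using A assms by (simp add: suminf_emeasure)
  qed
  then show "emeasure ?S A = ?\<mu> A" if "A \<in> sets M" for A
    using that sets.sigma_algebra_axioms
    by (intro emeasure_measure_of_sigma) (auto simp: positive_def)
qed

text \<open>Arbitrary Borel measures rather than Radon measures, so that suprema of chains stay in the
  class without regularity having to be carried along; maximality in the larger class is the stronger
  property.\<close>

definition borel_minorants :: "('a::t2_space set \<Rightarrow> ennreal) \<Rightarrow> 'a measure set" where
  "borel_minorants \<nu> = {m. sets m = sets borel \<and> (\<forall>A\<in>open_or_closed. emeasure m A \<le> \<nu> A)}"

lemma open_or_closed_borel: "A \<in> open_or_closed \<Longrightarrow> A \<in> sets borel"
  by (auto simp: open_or_closed_def)

text \<open>
  Zorn's lemma applies because the supremum of a chain of measures is computed setwise, so that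
  it obeys the same upper bounds as the members of the chain.
\<close>

lemma maximal_borel_minorant:
  fixes \<nu> :: "'a::t2_space set \<Rightarrow> ennreal"
  obtains m where "m \<in> borel_minorants \<nu>" "\<And>m'. m' \<in> borel_minorants \<nu> \<Longrightarrow> m \<le> m' \<Longrightarrow> m' = m"
proof -
  have "\<exists>m\<in>borel_minorants \<nu>. \<forall>m'\<in>borel_minorants \<nu>. m \<le> m' \<longrightarrow> m' = m"
  proof (rule predicate_Zorn)
    show "partial_order_on (borel_minorants \<nu>) (relation_of (\<le>) (borel_minorants \<nu>))"
      by (rule partial_order_on_relation_ofI) auto
    fix C assume "C \<in> Chains (relation_of (\<le>) (borel_minorants \<nu>))"
    then have sub: "C \<subseteq> borel_minorants \<nu>" and chain: "Complete_Partial_Order.chain (\<le>) C"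
      unfolding Chains_def relation_of_def Complete_Partial_Order.chain_def by auto
    show "\<exists>u\<in>borel_minorants \<nu>. \<forall>m\<in>C. m \<le> u"
    proof (cases "C = {}")
      case True
      have "null_measure borel \<in> borel_minorants \<nu>"
        by (auto simp: borel_minorants_def)
      then show ?thesis using True by blast
    next
      case False
      have C: "sets m = sets borel" "\<And>A. A \<in> open_or_closed \<Longrightarrow> emeasure m A \<le> \<nu> A" if "m \<in> C" for m
        using sub that by (auto simp: borel_minorants_def)
      have "emeasure (Sup C) A \<le> \<nu> A" if A: "A \<in> open_or_closed" for A
      proof -
        have "emeasure (SUP m\<in>C. m) A = (SUP m\<in>C. emeasure m A)"
          using C(1) chain False open_or_closed_borel[OF A]
          by (intro emeasure_SUP_chain[where N = borel]) auto
        also have "\<dots> \<le> \<nu> A" using C(2)[OF _ A] by (intro SUP_least)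
        finally show ?thesis by simp
      qed
      moreover have "sets (Sup C) = sets borel"
        using sets_SUP[of C "\<lambda>m. m" borel] C(1) False by simp
      ultimately have "Sup C \<in> borel_minorants \<nu>" by (simp add: borel_minorants_def)
      then show ?thesis by (auto intro: Sup_upper)
    qed
  qed
  then show ?thesis using that by blast
qed

definition dtm_minus_measure :: "('a::t2_space set \<Rightarrow> ennreal) \<Rightarrow> 'a measure \<Rightarrow> 'a set \<Rightarrow> ennreal" where
  "dtm_minus_measure \<nu> m = (\<lambda>A. if A \<in> open_or_closed then \<nu> A - emeasure m A else undefined)"

lemma dtm_minus_measure_add:
  assumes m: "m \<in> borel_minorants \<nu>" and A: "A \<in> open_or_closed"
  shows "dtm_minus_measure \<nu> m A + emeasure m A = \<nu> A"
  using m A by (auto simp: dtm_minus_measure_def borel_minorants_def intro: diff_add_cancel_ennreal)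

lemma borel_minorant_less_top:
  assumes \<nu>: "\<nu> \<in> DTM" and m: "m \<in> borel_minorants \<nu>" and A: "A \<in> open_or_closed"
  shows "emeasure m A < \<infinity>"
  using m A DTM_less_top[OF \<nu> A] by (auto simp: borel_minorants_def intro: order.strict_trans1)

lemma dtm_minus_measure_le_iff:
  assumes \<nu>: "\<nu> \<in> DTM" and m: "m \<in> borel_minorants \<nu>" and A: "A \<in> open_or_closed"
  shows "dtm_minus_measure \<nu> m A \<le> c \<longleftrightarrow> \<nu> A \<le> emeasure m A + c"
  using borel_minorant_less_top[OF \<nu> m A] A
  by (auto simp: dtm_minus_measure_def ennreal_minus_le_iff)

text \<open>
  Approximating sets for \<open>\<nu>\<close> also serve \<open>\<nu> - m\<close>, as passing to a smaller set only lowers \<open>m\<close>.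
  Monotonicity is where \<open>\<nu>\<close> has to compensate for \<open>m\<close>: for \<open>F \<subseteq> U\<close>, superadditivity gives
  \<open>\<nu>(U) \<ge> \<nu>(F) + \<nu>(U - F) \<ge> \<nu>(F) + m(U - F)\<close>.
\<close>

lemma dtm_minus_measure_in_DTM:
  fixes \<nu> :: "'a::t2_space set \<Rightarrow> ennreal"
  assumes \<nu>: "\<nu> \<in> DTM" and m: "m \<in> borel_minorants \<nu>"
  shows "dtm_minus_measure \<nu> m \<in> DTM"
proof (rule DTM_I)
  let ?\<rho> = "dtm_minus_measure \<nu> m"
  have sets: "sets m = sets borel" and le: "\<And>A. A \<in> open_or_closed \<Longrightarrow> emeasure m A \<le> \<nu> A"
    using m by (auto simp: borel_minorants_def)
  note sum = dtm_minus_measure_add[OF m] and le_iff = dtm_minus_measure_le_iff[OF \<nu> m]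
    and fin = borel_minorant_less_top[OF \<nu> m]
  have m_mono: "emeasure m A \<le> emeasure m B" if "A \<subseteq> B" "B \<in> open_or_closed" for A B
    using that sets by (intro emeasure_mono) (auto simp: open_or_closed_borel)
  show "?\<rho> \<in> extensional open_or_closed"
    by (simp add: dtm_minus_measure_def extensional_def)
  show "?\<rho> UNIV < \<infinity>"
    using le_less_trans[OF diff_le_self_ennreal DTM_less_top[OF \<nu>, of UNIV]]
    by (simp add: dtm_minus_measure_def open_or_closedI)
  show "?\<rho> (C \<union> K) = ?\<rho> C + ?\<rho> K" if CK: "compact C" "compact K" "C \<inter> K = {}" for C K
  proof -
    have ooc: "C \<in> open_or_closed" "K \<in> open_or_closed" "C \<union> K \<in> open_or_closed"
      using CK by (auto intro: open_or_closed_compactI compact_Un)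
    have add: "emeasure m (C \<union> K) = emeasure m C + emeasure m K"
      using CK sets ooc by (intro plus_emeasure[symmetric]) (auto simp: open_or_closed_borel)
    have "?\<rho> (C \<union> K) + emeasure m (C \<union> K) = (?\<rho> C + ?\<rho> K) + emeasure m (C \<union> K)"
      using DTM_additive_compact[OF \<nu> CK] sum[OF ooc(1)] sum[OF ooc(2)] sum[OF ooc(3)]
      by (metis add add.assoc add.commute add.left_commute)
    then show ?thesis
      using fin[OF ooc(3)] ennreal_add_left_cancel[of "emeasure m (C \<union> K)"] by (auto simp: add.commute)
  qed
  show "?\<rho> F \<le> ?\<rho> U" if F: "closed F" and U: "open U" and sub: "F \<subseteq> U" for F U
  proof -
    have op: "open (U - F)" using F U by (simp add: open_Diff)
    have ooc: "F \<in> open_or_closed" "U \<in> open_or_closed" "U - F \<in> open_or_closed"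
      using F U op by (auto intro: open_or_closedI)
    have split: "emeasure m U = emeasure m F + emeasure m (U - F)"
      using sub sets ooc plus_emeasure[of F m "U - F"]
      by (auto simp: open_or_closed_borel Un_absorb1)
    have "?\<rho> F + emeasure m U = \<nu> F + emeasure m (U - F)"
      unfolding split by (simp add: sum[OF ooc(1), symmetric] add.assoc)
    also have "\<dots> \<le> \<nu> F + \<nu> (U - F)"
      using le[OF ooc(3)] by (intro add_left_mono)
    also have "\<dots> \<le> \<nu> U"
      using sub by (intro DTM_superadditive[OF \<nu> F op U]) auto
    also have "\<dots> = ?\<rho> U + emeasure m U" by (simp add: sum[OF ooc(2)])
    finally show ?thesis
      using fin[OF ooc(2)] by (auto simp: add.commute ennreal_add_left_cancel_le)
  qed
  show "\<exists>C. compact C \<and> C \<subseteq> U \<and> ?\<rho> U \<le> ?\<rho> C + e" if U: "open U" and e: "e > 0" for U and e :: real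
  proof -
    obtain C where C: "compact C" "C \<subseteq> U" "\<nu> U \<le> \<nu> C + ennreal e"
      using DTM_approx_compact[OF \<nu> U e] .
    have ooc: "C \<in> open_or_closed" "U \<in> open_or_closed"
      using C(1) U by (auto intro: open_or_closedI)
    have "\<nu> U \<le> (?\<rho> C + emeasure m C) + ennreal e"
      using C(3) sum[OF ooc(1)] by simp
    also have "\<dots> \<le> (?\<rho> C + emeasure m U) + ennreal e"
      using m_mono[OF C(2) ooc(2)] by (intro add_mono) auto
    finally have "?\<rho> U \<le> ?\<rho> C + ennreal e"
      unfolding le_iff[OF ooc(2)] by (simp add: ac_simps)
    then show ?thesis using C by blast
  qed
  show "\<exists>U. open U \<and> F \<subseteq> U \<and> ?\<rho> U \<le> ?\<rho> F + e" if F: "closed F" and e: "e > 0" for F and e :: real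
  proof -
    obtain U where U: "open U" "F \<subseteq> U" "\<nu> U \<le> \<nu> F + ennreal e"
      using DTM_approx_open[OF \<nu> F e] .
    have ooc: "F \<in> open_or_closed" "U \<in> open_or_closed"
      using U(1) F by (auto intro: open_or_closedI)
    have "\<nu> U \<le> (?\<rho> F + emeasure m F) + ennreal e"
      using U(3) sum[OF ooc(1)] by simp
    also have "\<dots> \<le> (?\<rho> F + emeasure m U) + ennreal e"
      using m_mono[OF U(2) ooc(2)] by (intro add_mono) auto
    finally have "?\<rho> U \<le> ?\<rho> F + ennreal e"
      unfolding le_iff[OF ooc(2)] by (simp add: ac_simps)
    then show ?thesis using U by blast
  qed
qed

text \<open>If \<open>m' \<le> \<nu> - m\<close>, then \<open>m + m' \<le> \<nu>\<close>, so \<open>m + m' = m\<close> by maximality, and \<open>m' = 0\<close>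
  because \<open>m\<close> is finite.\<close>

lemma dtm_minus_maximal_proper:
  fixes \<nu> :: "'a::t2_space set \<Rightarrow> ennreal"
  assumes \<nu>: "\<nu> \<in> DTM" and m: "m \<in> borel_minorants \<nu>"
    and max: "\<And>m'. m' \<in> borel_minorants \<nu> \<Longrightarrow> m \<le> m' \<Longrightarrow> m' = m"
  shows "proper_dtm (dtm_minus_measure \<nu> m)"
  unfolding proper_dtm_def
proof (intro allI impI)
  fix m' :: "'a measure"
  assume radon: "radon_measure m'" and le: "\<forall>A\<in>open_or_closed. emeasure m' A \<le> dtm_minus_measure \<nu> m A"
  have sets: "sets m = sets borel" "sets m' = sets borel"
    using m radon by (auto simp: borel_minorants_def radon_measure_def)
  obtain s where s: "sets s = sets m" "\<And>A. A \<in> sets m \<Longrightarrow> emeasure s A = emeasure m A + emeasure m' A"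
    using emeasure_sum_exists[of m m'] sets by metis
  have "emeasure s A \<le> \<nu> A" if A: "A \<in> open_or_closed" for A
  proof -
    have "emeasure s A = emeasure m' A + emeasure m A"
      using s(2)[of A] open_or_closed_borel[OF A] sets by (simp add: add.commute)
    also have "\<dots> \<le> dtm_minus_measure \<nu> m A + emeasure m A"
      using le A by (intro add_right_mono) auto
    finally show ?thesis by (simp add: dtm_minus_measure_add[OF m A])
  qed
  then have "s \<in> borel_minorants \<nu>" using s(1) sets by (simp add: borel_minorants_def)
  moreover have "m \<le> s" using s by (simp add: le_measure)
  ultimately have "s = m" by (rule max)
  have UNIV: "UNIV \<in> (open_or_closed :: 'a set set)" by (simp add: open_or_closedI)
  have "emeasure m UNIV + emeasure m' UNIV = emeasure m UNIV + 0"
    using s(2)[of UNIV] sets \<open>s = m\<close> by simp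
  then have zero: "emeasure m' UNIV = 0"
    using borel_minorant_less_top[OF \<nu> m UNIV] by (simp only: ennreal_add_left_cancel) auto
  have "emeasure m' A = 0" if "A \<in> sets m'" for A
    using emeasure_mono[of A UNIV m'] zero sets by simp
  then show "m' = null_measure borel"
    using sets by (intro measure_eqI) auto
qed

lemma topological_measure_dtm_minus_measure:
  assumes \<nu>: "\<nu> \<in> DTM" and m: "m \<in> borel_minorants \<nu>"
    and tm: "topological_measure (dtm_minus_measure \<nu> m)"
  shows "topological_measure \<nu>"
  unfolding DTM_topological_measure_iff[OF \<nu>]
proof (intro allI impI)
  fix C U :: "'a set"
  assume CU: "compact C" "open U" "C \<subseteq> U"
  have ooc: "C \<in> open_or_closed" "U \<in> open_or_closed" "U - C \<in> open_or_closed"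
    using CU by (auto intro: open_or_closedI simp: open_Diff compact_imp_closed)
  have "emeasure m U = emeasure m C + emeasure m (U - C)"
    using CU m ooc plus_emeasure[of C m "U - C"]
    by (auto simp: borel_minorants_def open_or_closed_borel Un_absorb1)
  then show "\<nu> U = \<nu> C + \<nu> (U - C)"
    using tm[unfolded DTM_topological_measure_iff[OF dtm_minus_measure_in_DTM[OF \<nu> m]], rule_format, OF CU]
      ooc by (simp add: dtm_minus_measure_add[OF m, symmetric] ac_simps)
qed

section \<open>The equivalence\<close>

theorem theorem58:
  assumes "locally_compact_space (euclidean :: 'a::t2_space topology)"
  shows "(nowhere_dense_in weak_topology (TM :: ('a set \<Rightarrow> ennreal) set)
            \<longleftrightarrow> (\<exists>\<nu>::'a set \<Rightarrow> ennreal. \<nu> \<in> DTM \<and> \<not> topological_measure \<nu>))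
       \<and> ((\<exists>\<nu>::'a set \<Rightarrow> ennreal. \<nu> \<in> DTM \<and> \<not> topological_measure \<nu>)
            \<longleftrightarrow> (\<exists>\<nu>::'a set \<Rightarrow> ennreal. \<nu> \<in> DTM \<and> (\<exists>A\<in>open_or_closed. \<nu> A \<noteq> 0) \<and>
                   proper_dtm \<nu> \<and> \<not> topological_measure \<nu>))"
proof -
  let ?one = "nowhere_dense_in weak_topology (TM :: ('a set \<Rightarrow> ennreal) set)"
  let ?two = "\<exists>\<nu>::'a set \<Rightarrow> ennreal. \<nu> \<in> DTM \<and> \<not> topological_measure \<nu>"
  let ?three = "\<exists>\<nu>::'a set \<Rightarrow> ennreal. \<nu> \<in> DTM \<and> (\<exists>A\<in>open_or_closed. \<nu> A \<noteq> 0) \<and>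
    proper_dtm \<nu> \<and> \<not> topological_measure \<nu>"
  have "?two" if "?one"
  proof (rule ccontr)
    assume "\<not> ?two"
    then have "(TM :: ('a set \<Rightarrow> ennreal) set) = topspace weak_topology"
      using TM_subset_DTM by (auto simp: TM_def DTM_def)
    then have "(DTM :: ('a set \<Rightarrow> ennreal) set) = {}"
      using that unfolding nowhere_dense_in_def
      by (metis closure_of_topspace interior_of_topspace topspace_weak_topology)
    then show False using zero_in_DTM by blast
  qed
  moreover have "?one" if "?two"
    using that nowhere_dense_TM[OF assms] by blast
  moreover have "?three" if "?two"
  proof -
    obtain \<nu> :: "'a set \<Rightarrow> ennreal" where \<nu>: "\<nu> \<in> DTM" "\<not> topological_measure \<nu>"
      using \<open>?two\<close> by blast
    obtain m where m: "m \<in> borel_minorants \<nu>"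
      and max: "\<And>m'. m' \<in> borel_minorants \<nu> \<Longrightarrow> m \<le> m' \<Longrightarrow> m' = m"
      by (rule maximal_borel_minorant[of \<nu>]) (rule that)
    let ?\<rho> = "dtm_minus_measure \<nu> m"
    have \<rho>: "?\<rho> \<in> DTM" by (rule dtm_minus_measure_in_DTM[OF \<nu>(1) m])
    have not_tm: "\<not> topological_measure ?\<rho>"
      using topological_measure_dtm_minus_measure[OF \<nu>(1) m] \<nu>(2) by blast
    then have "\<exists>A\<in>open_or_closed. ?\<rho> A \<noteq> 0"
      using topological_measure_if_zero[OF \<rho>] by blast
    moreover have "proper_dtm ?\<rho>"
      using \<nu>(1) m max by (rule dtm_minus_maximal_proper)
    ultimately show ?thesis using \<rho> not_tm by blast
  qed
  moreover have "?two" if "?three" using that by blast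
  ultimately show ?thesis by blast
qed

end
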